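(* Let $(V,b)$ be an orthogonal bilinear space over $\mathbb{F}_2$ of even dimension, and let $\sigma$ be an involution in $\mathrm{Iso}(V,b)$. Write $I_j=I_j(\sigma)$. Then: \begin{itemize} \item[(a)] $I_1+I_2+I_3=2^{\dim V-1}=I_4+I_5+I_6$. \item[(b)] $I_5,I_7,I_8\in\{0,I_1\}$. \item[(c)] At most one of $I_5,I_7,I_8$ is nonzero. \item[(d)] $D(\sigma)=\dim V-\log_2(I_1+I_5)$. \item[(e)] $\tilde D(\sigma)=\dim V-\log_2(I_1+I_8)$. \item[(f)] $\alpha(\sigma)=0 \iff (I_4=2^{\dim V-1}\text{ and }I_3=0)\iff I_4=2^{\dim V-1}$. \item[(g)] $\tilde\alpha(\sigma)=0\iff I_3=I_4=0\iff I_4=0$. \item[(h)] $\log_2(I_1)=\dim V-\max\{D(\sigma),\tilde D(\sigma)\}$. \item[(i)] $I_3=0$ if $\alpha(\sigma)\ne\tilde\alpha(\sigma)$, and $I_3=2^{\dim V-2}$ if $\alpha(\sigma)=\tilde\alpha(\sigma)$; and $I_4=0$ if $\alpha(\sigma)>\tilde\alpha(\sigma)$, $I_4=2^{\dim V-1}$ if $\alpha(\sigma)<\tilde\alpha(\sigma)$, $I_4=2^{\dim V-2}$ if $\alpha(\sigma)=\tilde\alpha(\sigma)$. \item[(j)] $I_5=0$ if $D(\sigma)\ge\tilde D(\sigma)$, and $I_5=2^{\dim V-1-D(\sigma)}$ if $D(\sigma)<\tilde D(\sigma)$. \item[(k)] $I_7=0$ if $D(\sigma)\neq\tilde D(\sigma)$,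 and $I_7=2^{\dim V-D(\sigma)}$ if $D(\sigma)=\tilde D(\sigma)$. \item[(l)] $I_8=0$ if $D(\sigma)\le\tilde D(\sigma)$, and $I_8=2^{\dim V-1-\tilde D(\sigma)}$ if $D(\sigma)>\tilde D(\sigma)$. \end{itemize}
   Context: A bilinear space over $\mathbb{F}_2$ is a finite-dimensional $\mathbb{F}_2$-vector space $V$ with a nondegenerate symmetric bilinear form $b$; it is orthogonal if it is isomorphic to $\mathbb{F}_2^n$ with the standard dot product for some $n\ge1$. $\mathrm{Iso}(V,b)$ is its isometry group; an involution is $\sigma$ with $\sigma^2=\mathrm{Id}$ (identity included). $\Omega\in V$ is the unique vector with $b(\Omega,v)=b(v,v)$ for all $v$. The mirror of $\sigma$ is the involution $m\sigma\in\mathrm{Iso}(V,b)$ given by $(m\sigma)(v)=\sigma(v)+b(v,\Omega)\Omega$. $D(\sigma)=\mathrm{rank}(\sigma+\mathrm{Id})$; $\alpha(\sigma)=1$ if there is $v$ with $b(v,\sigma v)=1$ and $\alpha(\sigma)=0$ otherwise; $\tilde D(\sigma)=D(m\sigma)$, $\tilde\alpha(\sigma)=\alpha(m\sigma)$. The integers $I_j(\sigma)$ are the numbers of vectors $v\in V$ satisfying the following conditions: \begin{itemize} \item $I_1$: $b(v,v)=0$ and $v=\sigma v$; \item $I_2$: $b(v,v)=0$, $b(v,\sigma v)=0$ and $v\ne\sigma v$; \item $I_3$: $b(v,v)=0$ and $b(v,\sigma v)=1$; \item $I_4$: $b(v,v)=1$ and $b(v,\sigma v)=0$; \item $I_5$: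 $b(v,v)=1$ and $v=\sigma v$; \item $I_6$: $b(v,v)=1$, $b(v,\sigma v)=1$ and $v\neq\sigma v$; \item $I_7$: $v=\sigma v+\Omega$ and $b(v,v)=0$; \item $I_8$: $v=\sigma v+\Omega$ and $b(v,v)=1$. \end{itemize} *)

theory Defs
  imports Complex_Main "HOL-Library.Z2" "Jordan_Normal_Form.Matrix"
begin

text \<open>
  The field of two elements is the type \<^typ>\<open>bit\<close>. The space \<open>V\<close> is a whole type \<open>'v\<close> with scalar
  multiplication \<open>scale\<close>; the dimension of \<open>V\<close> is \<open>vector_space.dim scale UNIV\<close>.
\<close>

definition bilinear_space :: "(bit \<Rightarrow> 'v \<Rightarrow> 'v::ab_group_add) \<Rightarrow> ('v \<Rightarrow> 'v \<Rightarrow> bit) \<Rightarrow> bool" where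
  "bilinear_space scale b \<longleftrightarrow>
     (\<exists>B. finite_dimensional_vector_space scale B) \<and>
     (\<forall>v. Vector_Spaces.linear scale (*) (\<lambda>w. b v w)) \<and>
     (\<forall>w. Vector_Spaces.linear scale (*) (\<lambda>v. b v w)) \<and>
     (\<forall>v w. b v w = b w v) \<and>
     (\<forall>v. (\<forall>w. b v w = 0) \<longrightarrow> v = 0)"

text \<open>
  The standard space of dimension \<open>n\<close> is \<^term>\<open>carrier_vec n :: bit vec set\<close> with the dot product
  \<^const>\<open>scalar_prod\<close>. Linearity of \<open>f\<close> is written out because \<^typ>\<open>bit vec\<close> contains vectors of all
  lengths and so is not itself a vector space.
\<close>

definition orthogonal_space :: "(bit \<Rightarrow> 'v \<Rightarrow> 'v::ab_group_add) \<Rightarrow> ('v \<Rightarrow> 'v \<Rightarrow> bit) \<Rightarrow> bool" where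
  "orthogonal_space scale b \<longleftrightarrow>
     bilinear_space scale b \<and>
     (\<exists>n\<ge>1. \<exists>f :: 'v \<Rightarrow> bit vec.
        bij_betw f UNIV (carrier_vec n) \<and>
        (\<forall>v w. f (v + w) = f v + f w) \<and>
        (\<forall>c v. f (scale c v) = c \<cdot>\<^sub>v f v) \<and>
        (\<forall>v w. b v w = scalar_prod (f v) (f w)))"

definition Iso :: "(bit \<Rightarrow> 'v \<Rightarrow> 'v::ab_group_add) \<Rightarrow> ('v \<Rightarrow> 'v \<Rightarrow> bit) \<Rightarrow> ('v \<Rightarrow> 'v) set" where
  "Iso scale b = {\<sigma>. Vector_Spaces.linear scale scale \<sigma> \<and> bij \<sigma> \<and> (\<forall>v w. b (\<sigma> v) (\<sigma> w) = b v w)}"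

definition involution :: "('v \<Rightarrow> 'v) \<Rightarrow> bool" where
  "involution \<sigma> \<longleftrightarrow> \<sigma> \<circ> \<sigma> = id"

definition Omega :: "('v \<Rightarrow> 'v \<Rightarrow> bit) \<Rightarrow> 'v" where
  "Omega b = (THE w. \<forall>v. b w v = b v v)"

definition mirror :: "(bit \<Rightarrow> 'v \<Rightarrow> 'v::ab_group_add) \<Rightarrow> ('v \<Rightarrow> 'v \<Rightarrow> bit) \<Rightarrow> ('v \<Rightarrow> 'v) \<Rightarrow> 'v \<Rightarrow> 'v" where
  "mirror scale b \<sigma> v = \<sigma> v + scale (b v (Omega b)) (Omega b)"

definition D :: "(bit \<Rightarrow> 'v \<Rightarrow> 'v::ab_group_add) \<Rightarrow> ('v \<Rightarrow> 'v) \<Rightarrow> nat" where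
  "D scale \<sigma> = vector_space.dim scale (range (\<lambda>v. \<sigma> v + v))"

definition alpha :: "('v \<Rightarrow> 'v \<Rightarrow> bit) \<Rightarrow> ('v \<Rightarrow> 'v) \<Rightarrow> nat" where
  "alpha b \<sigma> = (if \<exists>v. b v (\<sigma> v) = 1 then 1 else 0)"

definition D_tilde :: "(bit \<Rightarrow> 'v \<Rightarrow> 'v::ab_group_add) \<Rightarrow> ('v \<Rightarrow> 'v \<Rightarrow> bit) \<Rightarrow> ('v \<Rightarrow> 'v) \<Rightarrow> nat" where
  "D_tilde scale b \<sigma> = D scale (mirror scale b \<sigma>)"

definition alpha_tilde :: "(bit \<Rightarrow> 'v \<Rightarrow> 'v::ab_group_add) \<Rightarrow> ('v \<Rightarrow> 'v \<Rightarrow> bit) \<Rightarrow> ('v \<Rightarrow> 'v) \<Rightarrow> nat" where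
  "alpha_tilde scale b \<sigma> = alpha b (mirror scale b \<sigma>)"

definition I1 :: "('v \<Rightarrow> 'v \<Rightarrow> bit) \<Rightarrow> ('v \<Rightarrow> 'v) \<Rightarrow> nat" where
  "I1 b \<sigma> = card {v. b v v = 0 \<and> v = \<sigma> v}"

definition I2 :: "('v \<Rightarrow> 'v \<Rightarrow> bit) \<Rightarrow> ('v \<Rightarrow> 'v) \<Rightarrow> nat" where
  "I2 b \<sigma> = card {v. b v v = 0 \<and> b v (\<sigma> v) = 0 \<and> v \<noteq> \<sigma> v}"

definition I3 :: "('v \<Rightarrow> 'v \<Rightarrow> bit) \<Rightarrow> ('v \<Rightarrow> 'v) \<Rightarrow> nat" where
  "I3 b \<sigma> = card {v. b v v = 0 \<and> b v (\<sigma> v) = 1}"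

definition I4 :: "('v \<Rightarrow> 'v \<Rightarrow> bit) \<Rightarrow> ('v \<Rightarrow> 'v) \<Rightarrow> nat" where
  "I4 b \<sigma> = card {v. b v v = 1 \<and> b v (\<sigma> v) = 0}"

definition I5 :: "('v \<Rightarrow> 'v \<Rightarrow> bit) \<Rightarrow> ('v \<Rightarrow> 'v) \<Rightarrow> nat" where
  "I5 b \<sigma> = card {v. b v v = 1 \<and> v = \<sigma> v}"

definition I6 :: "('v \<Rightarrow> 'v \<Rightarrow> bit) \<Rightarrow> ('v \<Rightarrow> 'v) \<Rightarrow> nat" where
  "I6 b \<sigma> = card {v. b v v = 1 \<and> b v (\<sigma> v) = 1 \<and> v \<noteq> \<sigma> v}"

definition I7 :: "('v::ab_group_add \<Rightarrow> 'v \<Rightarrow> bit) \<Rightarrow> ('v \<Rightarrow> 'v) \<Rightarrow> nat" where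
  "I7 b \<sigma> = card {v. v = \<sigma> v + Omega b \<and> b v v = 0}"

definition I8 :: "('v::ab_group_add \<Rightarrow> 'v \<Rightarrow> bit) \<Rightarrow> ('v \<Rightarrow> 'v) \<Rightarrow> nat" where
  "I8 b \<sigma> = card {v. v = \<sigma> v + Omega b \<and> b v v = 1}"

end

theory Submission
  imports Defs "HOL-Library.Product_Plus"
begin

text \<open>
  Apart from \<open>I\<^sub>2\<close> and \<open>I\<^sub>6\<close>, which are determined by (a), the numbers \<open>I\<^sub>j\<close> count fibres of
  additive maps, so each is zero or the size of a kernel.
  \<open>I\<^sub>1, I\<^sub>5, I\<^sub>7, I\<^sub>8\<close> are the fibres of \<open>v \<mapsto> (b(v,v), \<sigma>v + v)\<close> over
  \<open>(0,0), (1,0), (0,\<Omega>), (1,\<Omega>)\<close>. If \<open>\<Omega> = \<sigma>v + v\<close> for some \<open>v\<close>, then every fixed vector \<open>u\<close>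
  satisfies \<open>b(u,u) = b(u,\<Omega>) = 0\<close>; conversely, if all fixed vectors are isotropic, then \<open>\<Omega>\<close> is
  orthogonal to the kernel of \<open>\<sigma> + Id\<close>, hence lies in its image. So exactly one of
  \<open>I\<^sub>5, I\<^sub>7, I\<^sub>8\<close> is nonzero. The kernels of \<open>\<sigma> + Id\<close> and \<open>m\<sigma> + Id\<close> have \<open>I\<^sub>1 + I\<^sub>5\<close> and
  \<open>I\<^sub>1 + I\<^sub>8\<close> elements, which gives the ranks.

  The function \<open>f(v) = b(v,\<sigma>v)\<close> is additive because \<open>\<sigma>\<close> is self-adjoint, and so is
  \<open>g(v) = b(v,v) \<noteq> 0\<close>. Then \<open>\<alpha>(\<sigma>) = 0\<close> iff \<open>f = 0\<close>, the mirror has \<open>\<alpha>(m\<sigma>) = 0\<close> iff \<open>f = g\<close>, and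
  otherwise \<open>f\<close> and \<open>g\<close> are independent and every fibre of \<open>(g,f)\<close> is a quarter of \<open>V\<close>;
  \<open>I\<^sub>3\<close> and \<open>I\<^sub>4\<close> are two of these fibres.
\<close>

section \<open>Counting fibres of additive maps\<close>

lemma UNIV_bit: "(UNIV :: bit set) = {0, 1}"
  by (auto simp: bit_not_zero_iff)

lemma card_UNIV_bit: "card (UNIV :: bit set) = 2"
  by (simp add: UNIV_bit)

declare add_bit_eq_xor [simp del]

lemma bit_add_self [simp]: "c + c = (0 :: bit)"
  by (cases c) (auto simp: add_bit_eq_xor)

text \<open>A nonempty fibre is a translate of the kernel.\<close>

lemma card_fiber_additive:
  assumes "additive h"
  shows "card {v. h v = h u} = card {v. h v = 0}"
proof -
  interpret additive h by fact
  have "{v. h v = h u} = (+) u ` {v. h v = 0}"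
  proof (intro equalityI subsetI)
    fix v assume "v \<in> {v. h v = h u}"
    then have "v = u + (v - u)" "h (v - u) = 0" by (simp_all add: diff)
    then show "v \<in> (+) u ` {v. h v = 0}" by blast
  qed (auto simp: add)
  then show ?thesis by (simp add: card_image)
qed

lemma card_fiber_additive_cases:
  assumes "additive h"
  shows "card {v. h v = c} \<in> {0, card {v. h v = 0}}"
proof (cases "\<exists>u. h u = c")
  case True
  then show ?thesis using card_fiber_additive[OF assms] by auto
qed auto

lemma card_range_times_kernel:
  fixes h :: "'a::ab_group_add \<Rightarrow> 'b::ab_group_add"
  assumes "additive h" "finite (UNIV :: 'a set)"
  shows "card (range h) * card {v. h v = 0} = card (UNIV :: 'a set)"
proof -
  have "card (UNIV :: 'a set) = (\<Sum>y \<in> range h. card {x \<in> UNIV. h x = y})"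
    using sum_fun_comp[of UNIV "range h" h "\<lambda>_. 1 :: nat"] assms(2) by simp
  also have "\<dots> = (\<Sum>y \<in> range h. card {v. h v = 0})"
    using card_fiber_additive[OF assms(1)] by (intro sum.cong) auto
  finally show ?thesis by simp
qed

lemma card_fiber_bit:
  fixes f :: "'a::ab_group_add \<Rightarrow> bit"
  assumes "additive f" "finite (UNIV :: 'a set)" "f u = 1"
  shows "2 * card {v. f v = c} = card (UNIV :: 'a set)"
proof -
  have f0: "f 0 = 0" by (rule additive.zero[OF assms(1)])
  have "c \<in> range f" for c by (cases c) (metis f0 assms(3) rangeI)+
  then have surj: "range f = UNIV" by blast
  then obtain w where "c = f w" by (metis surjD)
  then show ?thesis
    using card_range_times_kernel[OF assms(1,2)] card_fiber_additive[OF assms(1), of w] surj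
    by (simp add: card_UNIV_bit)
qed

text \<open>The maps \<open>f\<close>, \<open>g\<close> and \<open>f + g\<close> are all nonzero, so
  each of their fibres is half the group. The resulting linear equations for the four cells
  \<open>N c d\<close> force each cell to be a quarter.\<close>

lemma card_fiber_two_bits:
  fixes f g :: "'a::ab_group_add \<Rightarrow> bit"
  assumes f: "additive f" and g: "additive g" and fin: "finite (UNIV :: 'a set)"
    and "f u = 1" "g v = 1" "f w \<noteq> g w"
  shows "4 * card {v. f v = c \<and> g v = d} = card (UNIV :: 'a set)"
proof -
  define N where "N c d = card {v. f v = c \<and> g v = d}" for c d
  have fg: "additive (\<lambda>x. f x + g x)"
    using f g by (simp add: additive_def algebra_simps)
  have "f w + g w = 1" using assms(6) by (cases "f w"; cases "g w") auto
  note half = card_fiber_bit[OF f fin \<open>f u = 1\<close>] card_fiber_bit[OF g fin \<open>g v = 1\<close>]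
    card_fiber_bit[OF fg fin this]
  have split: "card {v. P v} = card {v. P v \<and> Q v} + card {v. P v \<and> \<not> Q v}" for P Q :: "'a \<Rightarrow> bool"
  proof -
    have "card {v. P v} = card ({v. P v \<and> Q v} \<union> {v. P v \<and> \<not> Q v})"
      by (rule arg_cong[where f = card]) blast
    also have "\<dots> = card {v. P v \<and> Q v} + card {v. P v \<and> \<not> Q v}"
      by (rule card_Un_disjoint) (auto intro: finite_subset[OF subset_UNIV fin])
    finally show ?thesis .
  qed
  have "card {v. f v = c} = N c 0 + N c 1" for c
    using split[of "\<lambda>v. f v = c" "\<lambda>v. g v = 0"] by (simp add: N_def)
  note this[of 0] this[of 1]
  moreover have "card {v. g v = 0} = N 0 0 + N 1 0"
    using split[of "\<lambda>v. g v = 0" "\<lambda>v. f v = 0"] by (simp add: N_def conj_commute[of "g _ = _"])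
  moreover have "card {v. f v + g v = 0} = N 0 0 + N 1 1"
  proof -
    have "{v. f v + g v = 0 \<and> f v = 0} = {v. f v = 0 \<and> g v = 0}"
      "{v. f v + g v = 0 \<and> f v \<noteq> 0} = {v. f v = 1 \<and> g v = 1}"
      by (auto simp: add_bit_eq_xor)
    then show ?thesis
      using split[of "\<lambda>v. f v + g v = 0" "\<lambda>v. f v = 0"] by (simp add: N_def)
  qed
  ultimately have "4 * N 0 0 = card (UNIV :: 'a set)" "4 * N 0 1 = card (UNIV :: 'a set)"
    "4 * N 1 0 = card (UNIV :: 'a set)" "4 * N 1 1 = card (UNIV :: 'a set)"
    using half(1)[of 0] half(1)[of 1] half(2)[of 0] half(3)[of 0] by linarith+
  then have "4 * N c d = card (UNIV :: 'a set)"
    by (cases c; cases d) auto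
  then show ?thesis by (simp add: N_def)
qed

section \<open>Finite vector spaces\<close>

context vector_space
begin

lemma card_span_independent:
  assumes "independent B" "finite B"
  shows "card (span B) = card (UNIV :: 'a set) ^ card B"
proof -
  let ?F = "B \<rightarrow>\<^sub>E (UNIV :: 'a set)" and ?L = "\<lambda>u. \<Sum>v\<in>B. u v *s v"
  have "inj_on ?L ?F"
  proof (rule inj_onI)
    fix u w assume uw: "u \<in> ?F" "w \<in> ?F" and "?L u = ?L w"
    then have "(\<Sum>v\<in>B. (u v - w v) *s v) = 0"
      by (simp add: scale_left_diff_distrib sum_subtractf)
    then have "u v - w v = 0" if "v \<in> B" for v
      using independentD[OF assms(1,2) subset_refl, of "\<lambda>v. u v - w v"] that by blast
    then show "u = w" using uw by (intro PiE_ext) auto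
  qed
  moreover have "?L ` ?F = span B"
  proof -
    have "?L u \<in> ?L ` ?F" for u
      \<comment> \<open>\<open>span_finite\<close> allows arbitrary coefficient functions;
        restricting to \<open>B\<close> gives the same sum and lands in the extensional functions
        \<open>?F\<close>.\<close>
      by (rule image_eqI[of _ _ "restrict u B"]) (auto intro: sum.cong)
    then show ?thesis unfolding span_finite[OF assms(2)] by auto
  qed
  ultimately show ?thesis
    using card_image[of ?L ?F] by (simp add: card_PiE assms(2))
qed

end

lemma (in finite_dimensional_vector_space) card_subspace:
  assumes "subspace S"
  shows "card S = card (UNIV :: 'a set) ^ dim S"
  using basis_subspace_exists[OF assms] card_span_independent by metis

text \<open>The only scalars are 0 and 1, so an additive subgroup is already a subspace.\<close>

lemma bit_subspace_range:
  fixes scale :: "bit \<Rightarrow> 'v::ab_group_add \<Rightarrow> 'v"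
  assumes "vector_space scale" "additive T"
  shows "module.subspace scale (range T)"
proof -
  interpret vector_space scale by fact
  have zero: "0 \<in> range T" using rangeI[of T 0] additive.zero[OF assms(2)] by simp
  have add: "x + y \<in> range T" if "x \<in> range T" "y \<in> range T" for x y
    using that by (auto simp flip: additive.add[OF assms(2)])
  have "scale c x \<in> range T" if "x \<in> range T" for c x
    using that zero by (cases c) auto
  then show ?thesis using zero add by (intro subspaceI) auto
qed

text \<open>Comparing cardinalities through this identifies the length \<open>k\<close> of the
  standard model with the dimension.\<close>

lemma card_carrier_vec_bit: "card (carrier_vec n :: bit vec set) = 2 ^ n"
proof -
  have "bij_betw vec_of_list {xs :: bit list. set xs \<subseteq> UNIV \<and> length xs = n} (carrier_vec n)"
    by (rule bij_betw_byWitness[where f' = list_of_vec])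
      (auto simp: vec_list list_vec intro: carrier_vecI)
  then have "card (carrier_vec n :: bit vec set) = card {xs :: bit list. set xs \<subseteq> UNIV \<and> length xs = n}"
    by (rule bij_betw_same_card[symmetric])
  also have "finite (UNIV :: bit set)" by (simp add: UNIV_bit)
  note card_lists_length_eq[OF this, of n]
  finally show ?thesis by (simp only: card_UNIV_bit)
qed

lemma mult_power2_eq_power2:
  fixes x :: nat
  assumes "x * 2 ^ m = 2 ^ n"
  obtains k where "x = 2 ^ k" "k + m = n"
proof -
  have "x > 0" using assms by (cases x) auto
  then have "1 * 2 ^ m \<le> x * 2 ^ m" by (intro mult_right_mono) auto
  then have "m \<le> n" using assms by simp
  then have "x * 2 ^ m = 2 ^ (n - m) * 2 ^ m"
    using assms by (simp flip: power_add)
  then show ?thesis using that[of "n - m"] \<open>m \<le> n\<close> by simp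
qed

section \<open>Isometric involutions over the field with two elements\<close>

text \<open>Scalars are left out: over the field with two elements additivity already gives
  linearity, and dimensions enter as cardinalities.\<close>

locale bit_involution =
  fixes b :: "'v::ab_group_add \<Rightarrow> 'v \<Rightarrow> bit" and \<sigma> :: "'v \<Rightarrow> 'v" and \<Omega> :: 'v
  assumes fin: "finite (UNIV :: 'v set)"
    and double: "v + v = (0 :: 'v)"
    and b_add: "b v (w + w') = b v w + b v w'"
    and b_sym: "b v w = b w v"
    and b_nondeg: "(\<And>w. b v w = 0) \<Longrightarrow> v = 0"
    and b_Omega: "b \<Omega> v = b v v"
    and Omega_nonzero: "\<Omega> \<noteq> 0"
    and \<sigma>_add: "\<sigma> (v + w) = \<sigma> v + \<sigma> w"
    and \<sigma>_invol: "\<sigma> (\<sigma> v) = v"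
    and \<sigma>_isom: "b (\<sigma> v) (\<sigma> w) = b v w"
begin

abbreviation V :: "'v set" where "V \<equiv> UNIV"

lemma finite_set [simp]: "finite (A :: 'v set)"
  using fin rev_finite_subset by blast

lemma eq_iff_add: "v = w \<longleftrightarrow> v + w = (0 :: 'v)"
  by (metis add_right_cancel double)

lemma b_add_left: "b (v + v') w = b v w + b v' w"
  by (metis b_add b_sym)

lemma b_zero [simp]: "b v 0 = 0"
  using b_add[of v 0 0] by simp

lemma b_zero_left [simp]: "b 0 v = 0"
  by (metis b_sym b_zero)

text \<open>The adjoint of an isometry is its inverse, which here is \<sigma> itself.\<close>

lemma b_\<sigma>: "b (\<sigma> v) w = b v (\<sigma> w)"
  by (metis \<sigma>_invol \<sigma>_isom)

lemma additive_norm: "additive (\<lambda>v. b v v)"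
  using b_add by (simp add: additive_def flip: b_Omega)

text \<open>By self-adjointness and symmetry the two cross terms agree, so they cancel in
  characteristic 2.\<close>

lemma additive_twisted: "additive (\<lambda>v. b v (\<sigma> v))"
proof
  fix v w
  have "b v (\<sigma> w) = b w (\<sigma> v)" by (metis b_\<sigma> b_sym)
  then have "b v (\<sigma> w) + b w (\<sigma> v) = 0" by (cases "b w (\<sigma> v)") auto
  then show "b (v + w) (\<sigma> (v + w)) = b v (\<sigma> v) + b w (\<sigma> w)"
    by (simp add: \<sigma>_add b_add b_add_left algebra_simps)
qed

lemma norm_surj: obtains v where "b v v = 1"
  using b_nondeg[of \<Omega>] Omega_nonzero b_Omega bit_not_zero_iff by metis

section \<open>Character sums and orthogonal complements\<close>

text \<open>The nontrivial character of the additive group of two elements, with integer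
  values.\<close>

definition chi :: "bit \<Rightarrow> int" where
  "chi c = (if c = 0 then 1 else -1)"

lemma chi_add: "chi (c + d) = chi c * chi d"
  by (cases c; cases d) (auto simp: chi_def)

text \<open>Orthogonality of characters: if some \<open>u\<close> in \<open>W\<close> has
  \<open>b u v = 1\<close>, translation by \<open>u\<close> permutes \<open>W\<close> and flips the
  sign of every term, so the sum equals its own negative.\<close>

lemma sum_chi:
  assumes closed: "\<And>v w. v \<in> W \<Longrightarrow> w \<in> W \<Longrightarrow> v + w \<in> W"
  shows "(\<Sum>w\<in>W. chi (b w v)) = (if \<forall>w\<in>W. b w v = 0 then int (card W) else 0)"
proof (cases "\<forall>w\<in>W. b w v = 0")
  case True
  then show ?thesis by (simp add: chi_def)
next
  case False
  then obtain u where u: "u \<in> W" "b u v = 1" by auto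
  have "bij_betw ((+) u) W W"
    by (rule bij_betw_byWitness[where f' = "(+) u"])
      (auto simp: closed u(1) double simp flip: add.assoc)
  then have "(\<Sum>w\<in>W. chi (b w v)) = (\<Sum>w\<in>W. chi (b (u + w) v))"
    by (rule sum.reindex_bij_betw[symmetric])
  also have "\<dots> = - (\<Sum>w\<in>W. chi (b w v))"
    by (simp add: b_add_left chi_add u(2) sum_negf chi_def[of 1])
  finally have "(\<Sum>w\<in>W. chi (b w v)) = 0" by simp
  then show ?thesis unfolding if_not_P[OF False] .
qed

text \<open>Nondegeneracy without bases: evaluate \<open>\<Sum>\<^sub>v \<Sum>\<^sub>w (-1)^b(w,v)\<close> in both orders.\<close>
lemma card_perp:
  assumes "0 \<in> W" and closed: "\<And>v w. v \<in> W \<Longrightarrow> w \<in> W \<Longrightarrow> v + w \<in> W"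
  shows "card W * card {v. \<forall>w\<in>W. b w v = 0} = card V"
proof -
  have "int (card W * card {v. \<forall>w\<in>W. b w v = 0}) = (\<Sum>v\<in>V. \<Sum>w\<in>W. chi (b w v))"
    by (simp add: sum_chi[OF closed] sum.If_cases mult.commute)
  also have "\<dots> = (\<Sum>w\<in>W. \<Sum>v\<in>V. chi (b v w))"
    by (subst sum.swap) (intro sum.cong refl arg_cong[where f = chi] b_sym)
  also have "\<dots> = (\<Sum>w\<in>W. if w = 0 then int (card V) else 0)"
  proof (intro sum.cong refl)
    fix w
    have "(\<forall>v\<in>V. b v w = 0) \<longleftrightarrow> w = 0" using b_nondeg[of w] b_sym by auto
    then show "(\<Sum>v\<in>V. chi (b v w)) = (if w = 0 then int (card V) else 0)"
      using sum_chi[of V w] by simp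
  qed
  also have "\<dots> = int (card V)"
    using assms(1) by simp
  finally show ?thesis by linarith
qed

lemma additive_plus_id: "additive (\<lambda>v. \<sigma> v + v)"
  by (simp add: additive_def \<sigma>_add algebra_simps)

lemma fixed_iff: "v = \<sigma> v \<longleftrightarrow> \<sigma> v + v = 0"
  by (metis eq_iff_add)

text \<open>Self-adjointness gives one inclusion. Both sides have the same size, since multiplying
  either by the number of fixed vectors gives \<open>card V\<close>.\<close>

lemma perp_fixed: "{v. \<forall>w\<in>{w. w = \<sigma> w}. b w v = 0} = range (\<lambda>v. \<sigma> v + v)"
proof (rule card_subset_eq[symmetric])
  show "range (\<lambda>v. \<sigma> v + v) \<subseteq> {v. \<forall>w\<in>{w. w = \<sigma> w}. b w v = 0}"
  proof safe
    fix v w assume "w = \<sigma> w"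
    then have "b w (\<sigma> v) = b w v" by (metis b_\<sigma>)
    then show "b w (\<sigma> v + v) = 0" by (cases "b w v") (auto simp: b_add)
  qed
  have "card {w. w = \<sigma> w} * card {v. \<forall>w\<in>{w. w = \<sigma> w}. b w v = 0} = card V"
    using additive.zero[OF additive_plus_id] \<sigma>_add by (intro card_perp) auto
  moreover have "card {w. w = \<sigma> w} * card (range (\<lambda>v. \<sigma> v + v)) = card V"
    using card_range_times_kernel[OF additive_plus_id] by (simp add: fixed_iff mult.commute)
  ultimately have eq: "card {w. w = \<sigma> w} * card (range (\<lambda>v. \<sigma> v + v)) =
      card {w. w = \<sigma> w} * card {v. \<forall>w\<in>{w. w = \<sigma> w}. b w v = 0}" and "card {w. w = \<sigma> w} \<noteq> 0"
    using fin by (argo, intro notI, simp)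
  show "card (range (\<lambda>v. \<sigma> v + v)) = card {v. \<forall>w\<in>{w. w = \<sigma> w}. b w v = 0}"
    by (rule iffD1[OF mult_left_cancel eq]) fact
qed auto

text \<open>\<open>I 0 0\<close>, \<open>I 1 0\<close>, \<open>I 0 \<Omega>\<close>, \<open>I 1 \<Omega>\<close> are the paper's \<open>I\<^sub>1, I\<^sub>5, I\<^sub>7, I\<^sub>8\<close>.\<close>
definition I :: "bit \<Rightarrow> 'v \<Rightarrow> nat" where
  "I c x = card {v. b v v = c \<and> v = \<sigma> v + x}"

section \<open>Which of the fibres \<open>I 1 0\<close>, \<open>I 0 \<Omega>\<close>,
  \<open>I 1 \<Omega>\<close> is nonempty\<close>

lemma I_eq_card_fiber: "I c x = card {v. (b v v, \<sigma> v + v) = (c, x)}"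
proof -
  have "v = \<sigma> v + x \<longleftrightarrow> \<sigma> v + v = x" for v
    by (metis add.left_commute add.right_neutral double)
  then show ?thesis by (simp add: I_def)
qed

lemma additive_pair: "additive (\<lambda>v. (b v v, \<sigma> v + v))"
  using additive_norm additive_plus_id by (simp add: additive_def)

lemma I_cases: "I c x \<in> {0, I 0 0}"
  using card_fiber_additive_cases[OF additive_pair] unfolding I_eq_card_fiber zero_prod_def by blast

lemma I_0_0_pos: "I 0 0 > 0"
  using additive.zero[OF additive_plus_id] b_zero[of 0]
  by (auto simp: I_eq_card_fiber card_gt_0_iff simp del: b_zero b_zero_left)

lemma I_nonzero_iff: "I c x \<noteq> 0 \<longleftrightarrow> (\<exists>v. b v v = c \<and> \<sigma> v + v = x)"
  by (simp add: I_eq_card_fiber)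

lemma I_Omega_if_I_1_0_eq_0:
  assumes "I 1 0 = 0"
  shows "I 0 \<Omega> \<noteq> 0 \<or> I 1 \<Omega> \<noteq> 0"
proof -
  have "b w w = 0" if "w = \<sigma> w" for w
    using assms that I_nonzero_iff[of 1 0] fixed_iff by (metis bit_not_zero_iff)
  \<comment> \<open>\<open>b w \<Omega> = b w w\<close>, so orthogonality of \<Omega> to the fixed
    vectors says exactly that they are isotropic.\<close>
  then have "\<Omega> \<in> {v. \<forall>w\<in>{w. w = \<sigma> w}. b w v = 0}"
    using b_Omega b_sym by auto
  then obtain v where "\<sigma> v + v = \<Omega>" unfolding perp_fixed by auto
  then show ?thesis unfolding I_nonzero_iff by (metis bit_not_zero_iff)
qed

lemma fixed_isotropic:
  assumes "\<sigma> v + v = \<Omega>" "\<sigma> u + u = 0"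
  shows "b u u = 0"
proof -
  have "u = \<sigma> u" using assms(2) fixed_iff by simp
  then have "b u (\<sigma> v) = b u v" by (metis b_\<sigma>)
  then have "b u (\<sigma> v + v) = 0" by (cases "b u v") (auto simp: b_add)
  then show ?thesis using assms(1) b_Omega b_sym by metis
qed

lemma I_trichotomy:
  obtains "I 1 0 = I 0 0" "I 0 \<Omega> = 0" "I 1 \<Omega> = 0"
  | "I 1 0 = 0" "I 0 \<Omega> = I 0 0" "I 1 \<Omega> = 0"
  | "I 1 0 = 0" "I 0 \<Omega> = 0" "I 1 \<Omega> = I 0 0"
proof -
  have exclusive: "I 1 0 = 0" if "I c \<Omega> \<noteq> 0" for c
    using that fixed_isotropic I_nonzero_iff by (metis zero_neq_one)
  have "\<not> (I 0 \<Omega> \<noteq> 0 \<and> I 1 \<Omega> \<noteq> 0)"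
  proof
    assume *: "I 0 \<Omega> \<noteq> 0 \<and> I 1 \<Omega> \<noteq> 0"
    then obtain v w where vw: "b v v = 0" "\<sigma> v + v = \<Omega>" "b w w = 1" "\<sigma> w + w = \<Omega>"
      unfolding I_nonzero_iff by blast
    \<comment> \<open>The sum of the two solutions would be a fixed vector of norm 1, but
      \<open>exclusive\<close> gives \<open>I 1 0 = 0\<close>.\<close>
    have "b (v + w) (v + w) = 1" "\<sigma> (v + w) + (v + w) = 0"
      using vw additive.add[OF additive_norm, of v w] additive.add[OF additive_plus_id, of v w] double
      by auto
    then show False using exclusive * I_nonzero_iff by metis
  qed
  then show ?thesis
    using that exclusive[of 0] exclusive[of 1] I_0_0_pos I_Omega_if_I_1_0_eq_0 I_cases[of 1 0] I_cases[of 0 \<Omega>] I_cases[of 1 \<Omega>] by auto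
qed

section \<open>The mirror and the two ranks\<close>

text \<open>The mirror without scalar multiplication: its coefficient \<open>b v \<Omega>\<close>
  equals \<open>b v v\<close>.\<close>

definition m\<sigma> :: "'v \<Rightarrow> 'v" where
  "m\<sigma> v = \<sigma> v + (if b v v = 0 then 0 else \<Omega>)"

lemma b_m\<sigma>: "b v (m\<sigma> v) = b v (\<sigma> v) + b v v"
  using b_Omega[of v] b_sym[of v \<Omega>] by (auto simp: m\<sigma>_def b_add)

lemma additive_m\<sigma>_plus_id: "additive (\<lambda>v. m\<sigma> v + v)"
proof
  fix v w
  have "(if b (v + w) (v + w) = 0 then 0 else \<Omega>) =
      (if b v v = 0 then 0 else \<Omega>) + (if b w w = 0 then 0 else \<Omega>)"
    unfolding additive.add[OF additive_norm] by (cases "b v v"; cases "b w w") (auto simp: double)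
  then show "m\<sigma> (v + w) + (v + w) = m\<sigma> v + v + (m\<sigma> w + w)"
    by (simp add: m\<sigma>_def \<sigma>_add algebra_simps)
qed

lemma card_range_plus_id: "card (range (\<lambda>v. \<sigma> v + v)) * (I 0 0 + I 1 0) = card V"
proof -
  have "I 0 0 + I 1 0 = card {v. \<sigma> v + v = 0}"
    unfolding I_eq_card_fiber by (subst card_Un_disjoint[symmetric]) (auto intro!: arg_cong[where f = card])
  then show ?thesis using card_range_times_kernel[OF additive_plus_id] by simp
qed

text \<open>An isotropic vector of the kernel is fixed by \<sigma>, while one of norm 1 satisfies
  \<open>v = \<sigma> v + \<Omega>\<close>.\<close>

lemma card_range_m\<sigma>_plus_id: "card (range (\<lambda>v. m\<sigma> v + v)) * (I 0 0 + I 1 \<Omega>) = card V"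
proof -
  have "m\<sigma> v + v = 0 \<longleftrightarrow> v = \<sigma> v + (if b v v = 0 then 0 else \<Omega>)" for v
    unfolding m\<sigma>_def by (metis eq_iff_add)
  then have "I 0 0 + I 1 \<Omega> = card {v. m\<sigma> v + v = 0}"
    unfolding I_def
    by (subst card_Un_disjoint[symmetric]) (auto intro!: arg_cong[where f = card] split: if_splits)
  then show ?thesis using card_range_times_kernel[OF additive_m\<sigma>_plus_id] by simp
qed

text \<open>Each case of \<open>I_trichotomy\<close> is put into the two rank equations. A kernel
  made of two equal fibres has \<open>2 ^ (k + 1)\<close> elements, which is the source of every
  \<open>+ 1\<close>.\<close>

lemma I_power2:
  assumes n: "card V = 2 ^ n" and d: "card (range (\<lambda>v. \<sigma> v + v)) = 2 ^ d"
    and e: "card (range (\<lambda>v. m\<sigma> v + v)) = 2 ^ e"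
  obtains k where "I 0 0 = 2 ^ k" "I 1 0 = 2 ^ k" "I 0 \<Omega> = 0" "I 1 \<Omega> = 0" "n = k + d + 1" "e = d + 1"
  | k where "I 0 0 = 2 ^ k" "I 1 0 = 0" "I 0 \<Omega> = 2 ^ k" "I 1 \<Omega> = 0" "n = k + d" "e = d"
  | k where "I 0 0 = 2 ^ k" "I 1 0 = 0" "I 0 \<Omega> = 0" "I 1 \<Omega> = 2 ^ k" "n = k + e + 1" "d = e + 1"
proof -
  have D: "2 ^ d * (I 0 0 + I 1 0) = 2 ^ n" "2 ^ e * (I 0 0 + I 1 \<Omega>) = 2 ^ n"
    using card_range_plus_id card_range_m\<sigma>_plus_id unfolding n d e by auto
  have once: "\<exists>k. I 0 0 = 2 ^ k \<and> k + m = n" if "2 ^ m * I 0 0 = 2 ^ n" for m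
    using that mult_power2_eq_power2[of "I 0 0" m n] by (metis mult.commute)
  have twice: "\<exists>k. I 0 0 = 2 ^ k \<and> k + Suc m = n" if "2 ^ m * (I 0 0 + I 0 0) = 2 ^ n" for m
    using that by (intro once) (simp add: algebra_simps mult_2)
  show ?thesis
  proof (rule I_trichotomy)
    assume I: "I 1 0 = I 0 0" "I 0 \<Omega> = 0" "I 1 \<Omega> = 0"
    with D once[of e] twice[of d] obtain k l where "I 0 0 = 2 ^ k" "k + e = n" "I 0 0 = 2 ^ l" "l + Suc d = n"
      by auto
    then show ?thesis using that(1)[of k] I by simp
  next
    assume I: "I 1 0 = 0" "I 0 \<Omega> = I 0 0" "I 1 \<Omega> = 0"
    with D once[of e] once[of d] obtain k l where "I 0 0 = 2 ^ k" "k + e = n" "I 0 0 = 2 ^ l" "l + d = n"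
      by auto
    then show ?thesis using that(2)[of k] I by simp
  next
    assume I: "I 1 0 = 0" "I 0 \<Omega> = 0" "I 1 \<Omega> = I 0 0"
    with D once[of d] twice[of e] obtain k l where "I 0 0 = 2 ^ k" "k + d = n" "I 0 0 = 2 ^ l" "l + Suc e = n"
      by auto
    then show ?thesis using that(3)[of k] I by simp
  qed
qed

section \<open>Joint fibres of the norm and of \<open>b v (\<sigma> v)\<close>\<close>

lemma card_norm: "2 * card {v. b v v = c} = card V"
  using norm_surj card_fiber_bit[OF additive_norm fin] by metis

text \<open>\<open>J 0 1\<close> and \<open>J 1 0\<close> are the paper's \<open>I\<^sub>3\<close> and \<open>I\<^sub>4\<close>.\<close>
definition J :: "bit \<Rightarrow> bit \<Rightarrow> nat" where
  "J c d = card {v. b v v = c \<and> b v (\<sigma> v) = d}"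

lemma J_trichotomy:
  obtains "\<forall>v. b v (\<sigma> v) = 0" "\<exists>v. b v (m\<sigma> v) = 1" "J 0 1 = 0" "2 * J 1 0 = card V"
  | "\<exists>v. b v (\<sigma> v) = 1" "\<forall>v. b v (m\<sigma> v) = 0" "J 0 1 = 0" "J 1 0 = 0"
  | "\<exists>v. b v (\<sigma> v) = 1" "\<exists>v. b v (m\<sigma> v) = 1" "4 * J 0 1 = card V" "4 * J 1 0 = card V"
proof -
  obtain x where x: "b x x = 1" by (rule norm_surj)
  \<comment> \<open>The additive map \<open>b v (\<sigma> v)\<close> is zero, or equals the norm, or
    is neither; the last case supplies the witnesses for \<open>card_fiber_two_bits\<close>.\<close>
  consider "\<forall>v. b v (\<sigma> v) = 0" | "\<forall>v. b v (\<sigma> v) = b v v"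
    | u w where "b u (\<sigma> u) = 1" "b w w \<noteq> b w (\<sigma> w)"
    by (metis bit_not_zero_iff)
  then show ?thesis
  proof cases
    case 1
    then show ?thesis using that(1) x card_norm[of 1] by (auto simp: b_m\<sigma> J_def)
  next
    case 2
    then have "\<forall>v. b v (m\<sigma> v) = 0" by (simp add: b_m\<sigma>)
    moreover have "J 0 1 = 0" "J 1 0 = 0" using 2 by (auto simp: J_def)
    ultimately show ?thesis using that(2) 2 x by metis
  next
    case 3
    have "b w (m\<sigma> w) = 1"
      using 3(2) by (cases "b w w"; cases "b w (\<sigma> w)") (auto simp: b_m\<sigma>)
    then show ?thesis
      using that(3) 3 card_fiber_two_bits[OF additive_norm additive_twisted fin x 3] by (auto simp: J_def)
  qed
qed

end

section \<open>From orthogonal spaces to the locale\<close>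

text \<open>In the standard model \<Omega> is the all-ones vector: since \<open>c * c = c\<close>,
  its dot product with \<open>v\<close> is the norm of \<open>v\<close>.\<close>

lemma orthogonal_space_Omega:
  fixes scale :: "bit \<Rightarrow> 'v \<Rightarrow> 'v::ab_group_add"
  assumes orth: "orthogonal_space scale b"
    and dim: "n = vector_space.dim scale (UNIV :: 'v set)" and "even n"
  shows "card (UNIV :: 'v set) = 2 ^ n" "b (Omega b) v = b v v" "Omega b \<noteq> 0" "2 \<le> n"
proof -
  have bil: "bilinear_space scale b" using orth by (simp add: orthogonal_space_def)
  then obtain Bs where "finite_dimensional_vector_space scale Bs"
    unfolding bilinear_space_def by blast
  then interpret finite_dimensional_vector_space scale Bs .
  have b_add: "b (v + v') w = b v w + b v' w" for v v' w
    using bil unfolding bilinear_space_def Vector_Spaces.linear_def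
    by (blast dest: module_hom.add)
  have nondeg: "v = 0" if "\<And>w. b v w = 0" for v
    using bil that unfolding bilinear_space_def by blast
  obtain k f where "k \<ge> 1" and f: "bij_betw f UNIV (carrier_vec k)"
    and dot: "\<And>v w. b v w = scalar_prod (f v) (f w)"
    using orth unfolding orthogonal_space_def by blast
  show card: "card (UNIV :: 'v set) = 2 ^ n"
    using card_subspace[OF subspace_UNIV] dim by (simp add: card_UNIV_bit)
  with bij_betw_same_card[OF f] have "k = n" by (simp add: card_carrier_vec_bit)
  have f_carrier: "f v \<in> carrier_vec n" for v
    using bij_betwE[OF f] \<open>k = n\<close> by blast
  have f_surj: "\<exists>v. f v = x" if "x \<in> carrier_vec n" for x
    using that f \<open>k = n\<close> by (metis bij_betw_imp_surj_on imageE)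
  obtain e where e: "f e = vec n (\<lambda>_. 1)" using f_surj vec_carrier by blast
  have idem: "c * c = c" for c :: bit by (cases c) auto
  have e_norm: "b e v = b v v" for v
    using f_carrier[of v] by (simp add: dot e scalar_prod_def idem del: mult_bit_eq_and)
  \<comment> \<open>A vector of norm 1 shows that \<open>e\<close> is nonzero; index 0 exists
    because \<open>k\<close> is at least 1.\<close>
  obtain u where u: "f u = unit_vec n 0" using f_surj unit_vec_carrier by blast
  have "b u u = 1"
    using \<open>k \<ge> 1\<close> \<open>k = n\<close> unfolding dot u by (subst scalar_prod_left_unit) auto
  moreover have "b 0 u = 0" using b_add[of 0 0 u] by simp
  ultimately have "e \<noteq> 0" using e_norm[of u] by auto
  have unique: "w = e" if w: "\<forall>v. b w v = b v v" for w
  proof -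
    have "b (w - e) v = 0" for v
      using b_add[of "w - e" e v] w e_norm by simp
    then show ?thesis using nondeg by force
  qed
  have "Omega b = e"
    unfolding Omega_def using e_norm unique by (intro the_equality) auto
  show "b (Omega b) v = b v v" "Omega b \<noteq> 0"
    unfolding \<open>Omega b = e\<close> by fact+
  \<comment> \<open>Evenness rules out dimension 1, which makes \<open>n - 2\<close> a genuine
    subtraction.\<close>
  show "2 \<le> n" using \<open>even n\<close> \<open>k \<ge> 1\<close> \<open>k = n\<close> by presburger
qed

lemma bit_involution_orthogonal_space:
  fixes scale :: "bit \<Rightarrow> 'v \<Rightarrow> 'v::ab_group_add"
  assumes orth: "orthogonal_space scale b"
    and dim: "n = vector_space.dim scale (UNIV :: 'v set)" "even n"
    and iso: "\<sigma> \<in> Iso scale b" and inv: "involution \<sigma>"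
  shows "bit_involution b \<sigma> (Omega b)"
proof -
  have bil: "bilinear_space scale b" using orth by (simp add: orthogonal_space_def)
  then have "vector_space scale"
    unfolding bilinear_space_def finite_dimensional_vector_space_def by blast
  then interpret vector_space scale .
  note Omega = orthogonal_space_Omega[OF orth dim]
  show ?thesis
  proof
    show "finite (UNIV :: 'v set)"
      using Omega(1) by (intro card_ge_0_finite) simp
    show "v + v = 0" for v :: 'v
      using scale_left_distrib[of 1 1 v] by simp
    show "b v (w + w') = b v w + b v w'" for v w w'
      using bil unfolding bilinear_space_def Vector_Spaces.linear_def
      by (blast dest: module_hom.add)
    show "b v w = b w v" for v w
      using bil unfolding bilinear_space_def by blast
    show "v = 0" if "\<And>w. b v w = 0" for v
      using bil that unfolding bilinear_space_def by blast
    show "\<sigma> (v + w) = \<sigma> v + \<sigma> w" for v w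
      using iso unfolding Iso_def Vector_Spaces.linear_def by (blast dest: module_hom.add)
    show "\<sigma> (\<sigma> v) = v" for v
      using inv unfolding involution_def by (metis comp_apply id_apply)
    show "b (\<sigma> v) (\<sigma> w) = b v w" for v w
      using iso unfolding Iso_def by blast
  qed (fact Omega)+
qed

lemma card_range_plus_id_eq_D:
  assumes "bilinear_space scale b" "additive (\<lambda>v. \<sigma> v + v)"
  shows "card (range (\<lambda>v. \<sigma> v + v)) = 2 ^ D scale \<sigma>"
proof -
  obtain Bs where "finite_dimensional_vector_space scale Bs"
    using assms(1) unfolding bilinear_space_def by blast
  then interpret finite_dimensional_vector_space scale Bs .
  show ?thesis
    using card_subspace[OF bit_subspace_range[OF vector_space_axioms assms(2)]]
    by (simp add: D_def card_UNIV_bit)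
qed

theorem proposition3p5:
  fixes scale :: "bit \<Rightarrow> 'v \<Rightarrow> 'v::ab_group_add"
    and b :: "'v \<Rightarrow> 'v \<Rightarrow> bit"
    and \<sigma> :: "'v \<Rightarrow> 'v"
    and n :: nat
  assumes "orthogonal_space scale b"
    and "n = vector_space.dim scale (UNIV :: 'v set)"
    and "even n"
    and "\<sigma> \<in> Iso scale b"
    and "involution \<sigma>"
  shows
    "(I1 b \<sigma> + I2 b \<sigma> + I3 b \<sigma> = 2 ^ (n - 1) \<and> I4 b \<sigma> + I5 b \<sigma> + I6 b \<sigma> = 2 ^ (n - 1)) \<and>
     {I5 b \<sigma>, I7 b \<sigma>, I8 b \<sigma>} \<subseteq> {0, I1 b \<sigma>} \<and>
     (\<not> (I5 b \<sigma> \<noteq> 0 \<and> I7 b \<sigma> \<noteq> 0) \<and> \<not> (I5 b \<sigma> \<noteq> 0 \<and> I8 b \<sigma> \<noteq> 0) \<and>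
      \<not> (I7 b \<sigma> \<noteq> 0 \<and> I8 b \<sigma> \<noteq> 0)) \<and>
     real (D scale \<sigma>) = real n - log 2 (real (I1 b \<sigma> + I5 b \<sigma>)) \<and>
     real (D_tilde scale b \<sigma>) = real n - log 2 (real (I1 b \<sigma> + I8 b \<sigma>)) \<and>
     ((alpha b \<sigma> = 0 \<longleftrightarrow> (I4 b \<sigma> = 2 ^ (n - 1) \<and> I3 b \<sigma> = 0)) \<and>
      ((I4 b \<sigma> = 2 ^ (n - 1) \<and> I3 b \<sigma> = 0) \<longleftrightarrow> I4 b \<sigma> = 2 ^ (n - 1))) \<and>
     ((alpha_tilde scale b \<sigma> = 0 \<longleftrightarrow> (I3 b \<sigma> = 0 \<and> I4 b \<sigma> = 0)) \<and>
      ((I3 b \<sigma> = 0 \<and> I4 b \<sigma> = 0) \<longleftrightarrow> I4 b \<sigma> = 0)) \<and>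
     log 2 (real (I1 b \<sigma>)) = real n - real (max (D scale \<sigma>) (D_tilde scale b \<sigma>)) \<and>
     ((alpha b \<sigma> \<noteq> alpha_tilde scale b \<sigma> \<longrightarrow> I3 b \<sigma> = 0) \<and>
      (alpha b \<sigma> = alpha_tilde scale b \<sigma> \<longrightarrow> I3 b \<sigma> = 2 ^ (n - 2)) \<and>
      (alpha b \<sigma> > alpha_tilde scale b \<sigma> \<longrightarrow> I4 b \<sigma> = 0) \<and>
      (alpha b \<sigma> < alpha_tilde scale b \<sigma> \<longrightarrow> I4 b \<sigma> = 2 ^ (n - 1)) \<and>
      (alpha b \<sigma> = alpha_tilde scale b \<sigma> \<longrightarrow> I4 b \<sigma> = 2 ^ (n - 2))) \<and>
     ((D scale \<sigma> \<ge> D_tilde scale b \<sigma> \<longrightarrow> I5 b \<sigma> = 0) \<and>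
      (D scale \<sigma> < D_tilde scale b \<sigma> \<longrightarrow>
         real (I5 b \<sigma>) = 2 powi (int n - 1 - int (D scale \<sigma>)))) \<and>
     ((D scale \<sigma> \<noteq> D_tilde scale b \<sigma> \<longrightarrow> I7 b \<sigma> = 0) \<and>
      (D scale \<sigma> = D_tilde scale b \<sigma> \<longrightarrow>
         real (I7 b \<sigma>) = 2 powi (int n - int (D scale \<sigma>)))) \<and>
     ((D scale \<sigma> \<le> D_tilde scale b \<sigma> \<longrightarrow> I8 b \<sigma> = 0) \<and>
      (D scale \<sigma> > D_tilde scale b \<sigma> \<longrightarrow>
         real (I8 b \<sigma>) = 2 powi (int n - 1 - int (D_tilde scale b \<sigma>))))"
proof -
  have bil: "bilinear_space scale b" using assms(1) by (simp add: orthogonal_space_def)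
  then have "vector_space scale"
    unfolding bilinear_space_def finite_dimensional_vector_space_def by blast
  then interpret vector_space scale .
  interpret bit_involution b \<sigma> "Omega b"
    by (rule bit_involution_orthogonal_space[OF assms])
  have card_V: "card V = 2 ^ n" and "2 \<le> n"
    by (fact orthogonal_space_Omega(1,4)[OF assms(1-3)])+
  have mirror_eq: "mirror scale b \<sigma> = m\<sigma>"
  proof
    fix v
    have "b v (Omega b) = b v v" using b_Omega b_sym by metis
    then show "mirror scale b \<sigma> v = m\<sigma> v"
      by (cases "b v v") (auto simp: mirror_def m\<sigma>_def)
  qed
  \<comment> \<open>This keeps fixed vectors out of the sets counted by \<open>I3\<close> and
    \<open>I4\<close>, so the classes in (a) are disjoint.\<close>
  have fixed_norm: "b v (\<sigma> v) = b v v" if "v = \<sigma> v" for v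
    using that by simp
  have I_eqs: "I1 b \<sigma> = I 0 0" "I5 b \<sigma> = I 1 0" "I7 b \<sigma> = I 0 (Omega b)"
    "I8 b \<sigma> = I 1 (Omega b)" "I3 b \<sigma> = J 0 1" "I4 b \<sigma> = J 1 0"
    by (simp_all add: I1_def I3_def I4_def I5_def I7_def I8_def I_def J_def conj_commute)

  have card_split3: "card A + card B + card C = card S"
    if "S = A \<union> B \<union> C" "A \<inter> B = {}" "(A \<union> B) \<inter> C = {}" for A B C S :: "'v set"
    using that by (simp add: card_Un_disjoint)
  have "I1 b \<sigma> + I2 b \<sigma> + I3 b \<sigma> = card {v. b v v = 0}"
    unfolding I1_def I2_def I3_def using fixed_norm
    by (intro card_split3) (fastforce simp: bit_not_zero_iff)+
  moreover have "I4 b \<sigma> + I5 b \<sigma> + I6 b \<sigma> = card {v. b v v = 1}"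
    unfolding I4_def I5_def I6_def using fixed_norm
    by (intro card_split3) (fastforce simp: bit_not_zero_iff)+
  moreover have "2 * 2 ^ (n - 1) = (2 :: nat) ^ n"
    using \<open>2 \<le> n\<close> by (simp flip: power_Suc)
  ultimately have totals: "I1 b \<sigma> + I2 b \<sigma> + I3 b \<sigma> = 2 ^ (n - 1)"
    "I4 b \<sigma> + I5 b \<sigma> + I6 b \<sigma> = 2 ^ (n - 1)"
    using card_norm[of 0] card_norm[of 1] card_V by linarith+

  have D_tilde_eq: "D_tilde scale b \<sigma> = D scale m\<sigma>"
    by (simp add: D_tilde_def mirror_eq)
  have cards: "card (range (\<lambda>v. \<sigma> v + v)) = 2 ^ D scale \<sigma>"
    "card (range (\<lambda>v. m\<sigma> v + v)) = 2 ^ D_tilde scale b \<sigma>"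
    unfolding D_tilde_eq
    by (intro card_range_plus_id_eq_D[OF bil] additive_plus_id additive_m\<sigma>_plus_id)+
  have log_Suc: "log 2 (2 * 2 ^ k) = real (Suc k)" for k
    using log_pow_cancel[of 2 "Suc k"] by (simp only: power_Suc)
  have ranks: "{I5 b \<sigma>, I7 b \<sigma>, I8 b \<sigma>} \<subseteq> {0, I1 b \<sigma>} \<and>
     (\<not> (I5 b \<sigma> \<noteq> 0 \<and> I7 b \<sigma> \<noteq> 0) \<and> \<not> (I5 b \<sigma> \<noteq> 0 \<and> I8 b \<sigma> \<noteq> 0) \<and>
      \<not> (I7 b \<sigma> \<noteq> 0 \<and> I8 b \<sigma> \<noteq> 0)) \<and>
     real (D scale \<sigma>) = real n - log 2 (real (I1 b \<sigma> + I5 b \<sigma>)) \<and>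
     real (D_tilde scale b \<sigma>) = real n - log 2 (real (I1 b \<sigma> + I8 b \<sigma>)) \<and>
     log 2 (real (I1 b \<sigma>)) = real n - real (max (D scale \<sigma>) (D_tilde scale b \<sigma>)) \<and>
     ((D scale \<sigma> \<ge> D_tilde scale b \<sigma> \<longrightarrow> I5 b \<sigma> = 0) \<and>
      (D scale \<sigma> < D_tilde scale b \<sigma> \<longrightarrow>
         real (I5 b \<sigma>) = 2 powi (int n - 1 - int (D scale \<sigma>)))) \<and>
     ((D scale \<sigma> \<noteq> D_tilde scale b \<sigma> \<longrightarrow> I7 b \<sigma> = 0) \<and>
      (D scale \<sigma> = D_tilde scale b \<sigma> \<longrightarrow>
         real (I7 b \<sigma>) = 2 powi (int n - int (D scale \<sigma>)))) \<and>
     ((D scale \<sigma> \<le> D_tilde scale b \<sigma> \<longrightarrow> I8 b \<sigma> = 0) \<and>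
      (D scale \<sigma> > D_tilde scale b \<sigma> \<longrightarrow>
         real (I8 b \<sigma>) = 2 powi (int n - 1 - int (D_tilde scale b \<sigma>))))"
    unfolding I_eqs
    \<comment> \<open>The three cases of \<open>I_power2\<close> are exactly \<open>D\<close>
      smaller than, equal to and larger than \<open>D_tilde\<close>.\<close>
    by (rule I_power2[OF card_V cards]) (simp_all add: log_Suc)

  \<comment> \<open>With this form of \<open>n\<close> the truncated differences
    \<open>n - 1\<close> and \<open>n - 2\<close> simplify to \<open>Suc m\<close> and
    \<open>m\<close>.\<close>
  obtain m where m: "n = Suc (Suc m)"
    using \<open>2 \<le> n\<close> by (metis add_2_eq_Suc le_Suc_ex)
  have "alpha b \<sigma> = 0 \<and> alpha_tilde scale b \<sigma> = 1 \<and> J 0 1 = 0 \<and> J 1 0 = 2 * 2 ^ m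
    \<or> alpha b \<sigma> = 1 \<and> alpha_tilde scale b \<sigma> = 0 \<and> J 0 1 = 0 \<and> J 1 0 = 0
    \<or> alpha b \<sigma> = 1 \<and> alpha_tilde scale b \<sigma> = 1 \<and> J 0 1 = 2 ^ m \<and> J 1 0 = 2 ^ m"
    by (rule J_trichotomy) (auto simp: alpha_def alpha_tilde_def mirror_eq card_V m)
  then have alphas: "((alpha b \<sigma> = 0 \<longleftrightarrow> (I4 b \<sigma> = 2 ^ (n - 1) \<and> I3 b \<sigma> = 0)) \<and>
      ((I4 b \<sigma> = 2 ^ (n - 1) \<and> I3 b \<sigma> = 0) \<longleftrightarrow> I4 b \<sigma> = 2 ^ (n - 1))) \<and>
     ((alpha_tilde scale b \<sigma> = 0 \<longleftrightarrow> (I3 b \<sigma> = 0 \<and> I4 b \<sigma> = 0)) \<and>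
      ((I3 b \<sigma> = 0 \<and> I4 b \<sigma> = 0) \<longleftrightarrow> I4 b \<sigma> = 0)) \<and>
     ((alpha b \<sigma> \<noteq> alpha_tilde scale b \<sigma> \<longrightarrow> I3 b \<sigma> = 0) \<and>
      (alpha b \<sigma> = alpha_tilde scale b \<sigma> \<longrightarrow> I3 b \<sigma> = 2 ^ (n - 2)) \<and>
      (alpha b \<sigma> > alpha_tilde scale b \<sigma> \<longrightarrow> I4 b \<sigma> = 0) \<and>
      (alpha b \<sigma> < alpha_tilde scale b \<sigma> \<longrightarrow> I4 b \<sigma> = 2 ^ (n - 1)) \<and>
      (alpha b \<sigma> = alpha_tilde scale b \<sigma> \<longrightarrow> I4 b \<sigma> = 2 ^ (n - 2)))"
    unfolding I_eqs m by (elim disjE conjE) simp_all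
  from totals ranks alphas show ?thesis
    by - (elim conjE, intro conjI; assumption)
qed

end
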